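(* Let $G$ be a DAG with $n$ inputs and $n$ outputs that is maximally ST-robust with depth $d$. Then $G$ is $(n-1,d)$-source-to-sink-depth-robust.
   Context: For a DAG $G$ with a set $I$ of $n$ inputs and a set $O$ of $n$ outputs, $G$ is $(k_1,k_2,d)$-ST-robust if for every $D\subseteq V(G)$ with $|D|\le k_1$ there is a subgraph $H$ of $G-D$ with $|I\cap V(H)|\ge k_2$, $|O\cap V(H)|\ge k_2$, such that for every $s\in I\cap V(H)$ and $t\in O\cap V(H)$ there is a directed path from $s$ to $t$ in $H$ of length at least $d$; $G$ is maximally ST-robust with depth $d$ if it is $(k,n-k,d)$-ST-robust for all $0\le k\le n$. A DAG $G=(V,E)$ is $(e,d)$-source-to-sink-depth-robust if for every $S\subseteq V$ with $|S|\le e$, $G-S$ has a path of length at least $d$ that starts at a source node of $G$ and ends at a sink node of $G$ (here the inputs are the sources and the outputs are the sinks). *)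

theory Defs
  imports "Graph_Theory.Graph_Theory"
begin

locale dag = digraph +
  assumes acyclic: "\<not> cycle p"

definition sources :: "('a, 'b) pre_digraph \<Rightarrow> 'a set" where
  "sources G = {v \<in> verts G. in_arcs G v = {}}"

definition sinks :: "('a, 'b) pre_digraph \<Rightarrow> 'a set" where
  "sinks G = {v \<in> verts G. out_arcs G v = {}}"

definition del_verts :: "('a, 'b) pre_digraph \<Rightarrow> 'a set \<Rightarrow> ('a, 'b) pre_digraph" where
  "del_verts G D = G \<restriction> (verts G - D)"

text \<open>The length of a path is its number of arcs.\<close>

definition ST_robust ::
  "('a, 'b) pre_digraph \<Rightarrow> 'a set \<Rightarrow> 'a set \<Rightarrow> nat \<Rightarrow> nat \<Rightarrow> nat \<Rightarrow> bool" where
  "ST_robust G Inp Outp k1 k2 d \<longleftrightarrow>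
     (\<forall>D. D \<subseteq> verts G \<and> card D \<le> k1 \<longrightarrow>
       (\<exists>H. subgraph H (del_verts G D) \<and>
            card (Inp \<inter> verts H) \<ge> k2 \<and> card (Outp \<inter> verts H) \<ge> k2 \<and>
            (\<forall>s \<in> Inp \<inter> verts H. \<forall>t \<in> Outp \<inter> verts H.
               \<exists>p. pre_digraph.apath H s p t \<and> length p \<ge> d)))"

definition max_ST_robust ::
  "('a, 'b) pre_digraph \<Rightarrow> 'a set \<Rightarrow> 'a set \<Rightarrow> nat \<Rightarrow> nat \<Rightarrow> bool" where
  "max_ST_robust G Inp Outp n d \<longleftrightarrow> (\<forall>k \<le> n. ST_robust G Inp Outp k (n - k) d)"

text \<open>The first parameter is an integer, so that \<open>n - 1\<close> is not truncated at \<open>n = 0\<close>.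
  The sources and sinks are those of \<open>G\<close>, not of the graph left after the deletion.\<close>

definition source_to_sink_depth_robust ::
  "('a, 'b) pre_digraph \<Rightarrow> int \<Rightarrow> nat \<Rightarrow> bool" where
  "source_to_sink_depth_robust G e d \<longleftrightarrow>
     (\<forall>S. S \<subseteq> verts G \<and> int (card S) \<le> e \<longrightarrow>
       (\<exists>s \<in> sources G. \<exists>t \<in> sinks G. \<exists>p.
          pre_digraph.apath (del_verts G S) s p t \<and> length p \<ge> d))"

end

theory Submission
  imports Defs
begin

text \<open>Removing a set \<open>S\<close> of fewer than \<open>n\<close> vertices is the case k =
  |S| of maximal ST-robustness. The surviving subgraph \<open>H\<close> then keeps at least n - |S|
  \<ge> 1 inputs and as many outputs, so it contains some input and some output. These are a source
  and a sink of \<open>G\<close>, and the long path joining them in \<open>H\<close> is also a path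
  of \<open>G - S\<close>.\<close>

theorem theorem7:
  fixes G :: "('a, 'b) pre_digraph" and Inp Outp :: "'a set" and n d :: nat
  assumes "dag G"
    and "Inp = sources G" and "Outp = sinks G"
    and "card Inp = n" and "card Outp = n"
    and "max_ST_robust G Inp Outp n d"
  shows "source_to_sink_depth_robust G (int n - 1) d"
  unfolding source_to_sink_depth_robust_def
proof (intro allI impI)
  fix S
  assume S: "S \<subseteq> verts G \<and> int (card S) \<le> int n - 1"
  \<comment> \<open>The bound is an integer one: for \<open>n = 0\<close> it is negative and no
    \<open>S\<close> meets it, so the inequality is strict over the naturals too.\<close>
  then have less: "card S < n" by linarith
  then have "ST_robust G Inp Outp (card S) (n - card S) d"
    using assms(6) by (simp add: max_ST_robust_def)
  then have "\<exists>H. subgraph H (del_verts G S) \<and>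
      card (Inp \<inter> verts H) \<ge> n - card S \<and> card (Outp \<inter> verts H) \<ge> n - card S \<and>
      (\<forall>s \<in> Inp \<inter> verts H. \<forall>t \<in> Outp \<inter> verts H.
        \<exists>p. pre_digraph.apath H s p t \<and> length p \<ge> d)"
    using S by (simp only: ST_robust_def order_refl simp_thms)
  then obtain H where sub: "subgraph H (del_verts G S)"
    and card: "card (Inp \<inter> verts H) \<ge> n - card S" "card (Outp \<inter> verts H) \<ge> n - card S"
    and conn: "\<forall>s \<in> Inp \<inter> verts H. \<forall>t \<in> Outp \<inter> verts H.
      \<exists>p. pre_digraph.apath H s p t \<and> length p \<ge> d"
    by (elim exE conjE)
  \<comment> \<open>By \<open>less\<close> the truncated difference \<open>n - card S\<close> is
    positive, whereas an empty intersection would have cardinality 0.\<close>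
  have "Inp \<inter> verts H \<noteq> {}" "Outp \<inter> verts H \<noteq> {}"
    using card less by (metis card.empty diff_is_0_eq le_zero_eq not_le)+
  then obtain s t where s: "s \<in> Inp \<inter> verts H" and t: "t \<in> Outp \<inter> verts H"
    by blast
  then obtain p where p: "pre_digraph.apath H s p t" "length p \<ge> d"
    using conn by blast
  \<comment> \<open>Well-formedness of the ambient graph is part of \<open>subgraph\<close>; it
    allows paths of \<open>H\<close> to be lifted.\<close>
  interpret R: wf_digraph "del_verts G S"
    using sub by (simp add: subgraph_def)
  have "R.apath s p t"
    using p(1) sub by (rule R.subgraph_apath_imp_apath)
  then show "\<exists>s\<in>sources G. \<exists>t\<in>sinks G. \<exists>p.
      pre_digraph.apath (del_verts G S) s p t \<and> length p \<ge> d"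
    using s t p(2) assms(2,3) by blast
qed

end
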